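(* For $n\in\mathbb N$, $n\ge 1$, and $t\in\mathbb R$ let $b_n(t)=e^{t/2}e^{-\pi n^2e^{2t}}$, and let $$\phi_n(t)=2\bigl(2\pi^2n^4e^{9t/2}-3\pi n^2e^{5t/2}\bigr)e^{-\pi n^2e^{2t}} .$$ Then, for $t\ge0$, $$\phi_n(t)=\left(\frac{\partial^2}{\partial t^2}-\frac14\right)\left(e^{t/2}e^{-\pi n^2e^{2t}}\right).$$ Equivalently, with $v=2t\in\mathbb R$, $B_n(v)=e^{v/4}e^{-\pi n^2e^{v}}$ and $M=4\partial_v^2-\frac14$, one has, for $v\ge0$, $$\phi_n(v/2)=M B_n(v).$$
   Context: The functions $\phi_n$ are the theta modes of the Riemann kernel $\Phi(t)=\sum_{n\ge1}\phi_n(t)$, $t\ge0$. *)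

theory Defs
  imports "HOL-Analysis.Analysis"
begin

definition b :: "nat \<Rightarrow> real \<Rightarrow> real" where
  "b n t = exp (t / 2) * exp (- pi * (real n)^2 * exp (2 * t))"

definition phi :: "nat \<Rightarrow> real \<Rightarrow> real" where
  "phi n t = 2 * (2 * pi^2 * (real n)^4 * exp (9 * t / 2) - 3 * pi * (real n)^2 * exp (5 * t / 2))
     * exp (- pi * (real n)^2 * exp (2 * t))"

definition B :: "nat \<Rightarrow> real \<Rightarrow> real" where
  "B n v = exp (v / 4) * exp (- pi * (real n)^2 * exp v)"

(* deriv f x is an unspecified value where f is not differentiable, so the existence
   of second derivatives, implicit in the use of differential operators, is stated separately. *)
definition twice_differentiable_at :: "(real \<Rightarrow> real) \<Rightarrow> real \<Rightarrow> bool" where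
  "twice_differentiable_at f x \<longleftrightarrow>
     (\<forall>\<^sub>F y in nhds x. f differentiable (at y)) \<and> deriv f differentiable (at x)"

definition L :: "(real \<Rightarrow> real) \<Rightarrow> real \<Rightarrow> real" where
  "L f t = deriv (deriv f) t - 1 / 4 * f t"

definition M :: "(real \<Rightarrow> real) \<Rightarrow> real \<Rightarrow> real" where
  "M f v = 4 * deriv (deriv f) v - 1 / 4 * f v"

end

theory Submission imports Defs begin

text \<open>Both \<open>b n\<close> and \<open>B n\<close> have the form f(t) = exp(p t) exp(c exp(q
  t)) with c = -pi n^2. Since f' = (p + c q exp(q t)) f, differentiating again multiplies f by a
  quadratic polynomial in exp(q t) (\<open>second_derivative_exp_mult_exp_exp\<close>). With x = pi
  n^2 exp(2 t), \<open>phi_eq_mult_b\<close> gives \<open>phi n t\<close> the factor 4 x^2 - 6 x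
  over \<open>b n t\<close>, so each identity reduces to one between polynomials in x.\<close>

lemma has_real_derivative_exp_mult_exp_exp:
  fixes p q c t :: real
  shows "((\<lambda>t. exp (p * t) * exp (c * exp (q * t))) has_real_derivative
           (p + c * q * exp (q * t)) * (exp (p * t) * exp (c * exp (q * t)))) (at t)"
  by (auto intro!: derivative_eq_intros simp: algebra_simps)

lemma second_derivative_exp_mult_exp_exp:
  fixes p q c :: real
  assumes f: "f = (\<lambda>t. exp (p * t) * exp (c * exp (q * t)))"
  shows "twice_differentiable_at f t"
    and "deriv (deriv f) t = ((p + c * q * exp (q * t))\<^sup>2 + c * q\<^sup>2 * exp (q * t)) * f t"
proof -
  \<comment> \<open>Having this at every \<open>s\<close>, not just at \<open>t\<close>, identifies
    \<open>deriv f\<close> as a function and gives differentiability near \<open>t\<close>.\<close>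
  have d1: "(f has_real_derivative (p + c * q * exp (q * s)) * f s) (at s)" for s
    unfolding f by (rule has_real_derivative_exp_mult_exp_exp)
  have deriv_f: "deriv f = (\<lambda>s. (p + c * q * exp (q * s)) * f s)"
    using d1 by (auto intro: DERIV_imp_deriv)
  have "(deriv f has_real_derivative
          ((p + c * q * exp (q * t))\<^sup>2 + c * q\<^sup>2 * exp (q * t)) * f t) (at t)"
    unfolding deriv_f
    by (auto intro!: derivative_eq_intros d1 simp: algebra_simps power2_eq_square)
  then show "deriv (deriv f) t = ((p + c * q * exp (q * t))\<^sup>2 + c * q\<^sup>2 * exp (q * t)) * f t"
    and "twice_differentiable_at f t"
    using d1 by (auto simp: twice_differentiable_at_def real_differentiable_def
        intro: DERIV_imp_deriv always_eventually)
qed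

text \<open>The exponents 9/2 and 5/2 are 1/2 plus 4 and 2, so exp(t/2) factors out and leaves
  powers of exp(2 t).\<close>

lemma phi_eq_mult_b:
  "phi n t = (4 * (pi * (real n)\<^sup>2 * exp (2 * t))\<^sup>2 - 6 * (pi * (real n)\<^sup>2 * exp (2 * t))) * b n t"
proof -
  have e9: "exp (9 * t / 2) = exp (2 * t) * exp (2 * t) * exp (t / 2)"
    and e5: "exp (5 * t / 2) = exp (2 * t) * exp (t / 2)"
    by (simp_all flip: exp_add)
  show ?thesis
    unfolding phi_def b_def e9 e5 by (simp add: algebra_simps power2_eq_square power4_eq_xxxx)
qed

theorem lemma10p1:
  fixes n :: nat
  assumes "n \<ge> 1"
  shows "(\<forall>t::real. t \<ge> 0 \<longrightarrow> twice_differentiable_at (b n) t \<and> phi n t = L (b n) t) \<and>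
         (\<forall>v::real. v \<ge> 0 \<longrightarrow> twice_differentiable_at (B n) v \<and> phi n (v / 2) = M (B n) v)"
proof -
  have b: "b n = (\<lambda>t. exp (1 / 2 * t) * exp ((- pi * (real n)\<^sup>2) * exp (2 * t)))"
    and B: "B n = (\<lambda>v. exp (1 / 4 * v) * exp ((- pi * (real n)\<^sup>2) * exp (1 * v)))"
    by (simp_all add: b_def B_def fun_eq_iff)
  have b_half: "b n (v / 2) = B n v" for v
    by (simp add: b_def B_def)
  \<comment> \<open>Here p = 1/2, q = 2: (1/2 - 2 x)^2 - 4 x - 1/4 = 4 x^2 - 6 x.\<close>
  have "phi n t = L (b n) t" for t
    unfolding L_def second_derivative_exp_mult_exp_exp(2)[OF b] phi_eq_mult_b
    by (simp add: algebra_simps power2_eq_square)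
  \<comment> \<open>Here p = 1/4, q = 1 and x = pi n^2 exp(v): 4 ((1/4 - x)^2 - x) - 1/4 = 4 x^2 - 6
    x.\<close>
  moreover have "phi n (v / 2) = M (B n) v" for v
    unfolding M_def second_derivative_exp_mult_exp_exp(2)[OF B] phi_eq_mult_b b_half
    by (simp add: algebra_simps power2_eq_square)
  ultimately show ?thesis
    using second_derivative_exp_mult_exp_exp(1)[OF b] second_derivative_exp_mult_exp_exp(1)[OF B]
    by blast
qed

end
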